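(* Let $p$ be a prime with $p\equiv 5\pmod{24}$, and for $a\in\{1,-1\}$ let $$H_{NV^{(a)}(p)}=\begin{pmatrix} X-Y^T+aI_{p+1} & Y+X^T+aI_{p+1}\\ -Y^T-X-aI_{p+1} & X^T-Y+aI_{p+1}\end{pmatrix}.$$ Then $H_{NV^{(1)}(p)}$ is equivalent to $H(C_2\cup C_{2+\epsilon},\,C_0\cup C_{\epsilon+2})$, and $H_{NV^{(-1)}(p)}$ is equivalent to $H(C_0\cup C_{\epsilon},\,C_2\cup C_{\epsilon})$.
   Context: $\chi$ is the quadratic character of $\mathbb{F}_p$. Fix an ordering of $\mathbb{F}_p$; define $p\times p$ integer matrices $R_X,R_Y$ indexed by $\mathbb{F}_p$: $(R_X)_{u,v}=0$ if $u=v$ or $v-u$ is not a nonzero square, and $=\chi(c)$ if $v-u=c^2$, $c\ne0$; $(R_Y)_{u,v}=0$ if $u=v$ or $2(v-u)$ is not a nonzero square, and $=\chi(c)$ if $2(v-u)=c^2$, $c\neq0$. $X$ is the $(p+1)\times(p+1)$ matrix with first row $(0,1,\dots,1)$, first column $(0,-1,\dots,-1)^T$, lower-right block $R_X$; $Y$ has zero first row and column and lower-right block $R_Y$. Fix a primitive element $\omega$ of $\mathbb{F}_p$ and let $C_i=\omega^i\langle\omega^4\rangle$ ($i=0,1,2,3$), subscripts taken modulo $4$; $\epsilon\in\{1,3\}$ is the index with $-2\in C_\epsilon$. For $D\subseteq\mathbb{F}_p$, the type-1 matrix of $D$ is the $p\times p$ matrix $M=(m_{i,j})$ indexed by $\mathbb{F}_p$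 (same fixed ordering) with $m_{i,j}=1$ if $j-i\in D$ and $m_{i,j}=-1$ otherwise. For $D_1,D_2\subseteq\mathbb{F}_p$ with type-1 matrices $M_1,M_2$, and $\mathbf{1}$ the all-one row vector of length $p$, $$H(D_1,D_2)=\begin{pmatrix}1&1&\mathbf{1}&-\mathbf{1}\\ -1&1&-\mathbf{1}&-\mathbf{1}\\ -\mathbf{1}^T&\mathbf{1}^T&-M_1&-M_2\\ \mathbf{1}^T&\mathbf{1}^T&M_2^T&-M_1^T\end{pmatrix}.$$ Two $\{\pm1\}$-matrices $H,K$ are equivalent if $K=PHQ$ for some monomial matrices $P,Q$ with nonzero entries in $\{1,-1\}$. *)

theory Defs
  imports
    "HOL-Number_Theory.Euler_Criterion"
    "Berlekamp_Zassenhaus.Finite_Field"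
    "Jordan_Normal_Form.Matrix"
begin

text \<open>The field of \<open>p\<close> elements is \<^typ>\<open>'p mod_ring\<close> with \<open>'p :: prime_card\<close>, and \<open>p\<close> is
  \<open>CARD('p)\<close>. An ordering of the field is a bijection \<open>e\<close> from \<open>{..<CARD('p)}\<close> onto it; row and
  column \<open>i\<close> of a matrix indexed by the field belong to the element \<open>e i\<close>.\<close>

definition quad_char :: "'p :: prime_card mod_ring \<Rightarrow> int" where
  "quad_char x = (if x = 0 then 0 else if \<exists>y. x = y\<^sup>2 then 1 else - 1)"

text \<open>The value is independent of the chosen square root \<open>c\<close> if \<open>CARD('p) \<equiv> 1 (mod 4)\<close>;
  see \<open>root_char_eq\<close> below.\<close>

definition root_char :: "'p :: prime_card mod_ring \<Rightarrow> int" where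
  "root_char x =
    (if \<exists>c. c \<noteq> 0 \<and> x = c\<^sup>2 then quad_char (SOME c. c \<noteq> 0 \<and> x = c\<^sup>2) else 0)"

definition R_X :: "(nat \<Rightarrow> 'p :: prime_card mod_ring) \<Rightarrow> int mat" where
  "R_X e = mat CARD('p) CARD('p) (\<lambda>(i, j). root_char (e j - e i))"

definition R_Y :: "(nat \<Rightarrow> 'p :: prime_card mod_ring) \<Rightarrow> int mat" where
  "R_Y e = mat CARD('p) CARD('p) (\<lambda>(i, j). root_char (2 * (e j - e i)))"

definition ones_mat :: "nat \<Rightarrow> nat \<Rightarrow> int mat" where
  "ones_mat m n = mat m n (\<lambda>_. 1)"

definition X_mat :: "(nat \<Rightarrow> 'p :: prime_card mod_ring) \<Rightarrow> int mat" where
  "X_mat e = four_block_mat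
     (0\<^sub>m 1 1)               (ones_mat 1 CARD('p))
     (- ones_mat CARD('p) 1) (R_X e)"

definition Y_mat :: "(nat \<Rightarrow> 'p :: prime_card mod_ring) \<Rightarrow> int mat" where
  "Y_mat e = four_block_mat
     (0\<^sub>m 1 1)        (0\<^sub>m 1 CARD('p))
     (0\<^sub>m CARD('p) 1) (R_Y e)"

definition H_NV :: "int \<Rightarrow> (nat \<Rightarrow> 'p :: prime_card mod_ring) \<Rightarrow> int mat" where
  "H_NV a e =
    (let X = X_mat e; Y = Y_mat e; aI = a \<cdot>\<^sub>m 1\<^sub>m (CARD('p) + 1) in
     four_block_mat
       (X - transpose_mat Y + aI)   (Y + transpose_mat X + aI)
       (- transpose_mat Y - X - aI) (transpose_mat X - Y + aI))"

definition primitive_element :: "'p :: prime_card mod_ring \<Rightarrow> bool" where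
  "primitive_element \<omega> \<longleftrightarrow> \<omega> \<noteq> 0 \<and> (\<forall>x. x \<noteq> 0 \<longrightarrow> (\<exists>k :: nat. x = \<omega> ^ k))"

text \<open>Nonzero elements have finite multiplicative order, so the subgroup generated by
  \<open>\<omega> ^ 4\<close> consists of its powers with natural exponents.\<close>

definition quartic_class :: "'p :: prime_card mod_ring \<Rightarrow> nat \<Rightarrow> 'p mod_ring set" where
  "quartic_class \<omega> i = {\<omega> ^ (i mod 4) * (\<omega> ^ 4) ^ k | k :: nat. True}"

definition type1_mat ::
  "(nat \<Rightarrow> 'p :: prime_card mod_ring) \<Rightarrow> 'p mod_ring set \<Rightarrow> int mat" where
  "type1_mat e D = mat CARD('p) CARD('p) (\<lambda>(i, j). if e j - e i \<in> D then 1 else - 1)"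

definition H_mat ::
  "(nat \<Rightarrow> 'p :: prime_card mod_ring) \<Rightarrow> 'p mod_ring set \<Rightarrow> 'p mod_ring set \<Rightarrow> int mat" where
  "H_mat e D1 D2 =
    (let p = CARD('p); M1 = type1_mat e D1; M2 = type1_mat e D2 in
     four_block_mat
       (mat_of_rows_list 2 [[1, 1], [- 1, 1]])
       (four_block_mat
         (ones_mat 1 p)   (- ones_mat 1 p)
         (- ones_mat 1 p) (- ones_mat 1 p))
       (four_block_mat
         (- ones_mat p 1) (ones_mat p 1)
         (ones_mat p 1)   (ones_mat p 1))
       (four_block_mat
         (- M1)             (- M2)
         (transpose_mat M2) (- transpose_mat M1)))"

definition signed_monomial_mat :: "nat \<Rightarrow> int mat \<Rightarrow> bool" where
  "signed_monomial_mat n P \<longleftrightarrow>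
     P \<in> carrier_mat n n \<and> elements_mat P \<subseteq> {0, 1, - 1} \<and>
     (\<forall>i<n. \<exists>!j. j < n \<and> P $$ (i, j) \<noteq> 0) \<and>
     (\<forall>j<n. \<exists>!i. i < n \<and> P $$ (i, j) \<noteq> 0)"

definition pm_equivalent :: "int mat \<Rightarrow> int mat \<Rightarrow> bool" where
  "pm_equivalent H K \<longleftrightarrow>
     elements_mat H \<subseteq> {1, - 1} \<and> elements_mat K \<subseteq> {1, - 1} \<and>
     (\<exists>P Q. signed_monomial_mat (dim_row H) P \<and> signed_monomial_mat (dim_col H) Q \<and>
        K = P * H * Q)"

lemma minus_one_is_square:
  assumes "CARD('p :: prime_card) mod 4 = 1"
  shows "\<exists>y :: 'p mod_ring. y\<^sup>2 = - 1"
proof -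
  let ?p = "CARD('p)"
  have pr: "prime ?p" by (rule prime_card)
  have gt: "2 < ?p"
    using assms prime_ge_2_nat[OF pr] le_neq_implies_less[of 2 ?p] by fastforce
  have k: "?p - 1 = 4 * (?p div 4)"
    using assms mult_div_mod_eq[of 4 ?p] by simp
  have ev: "(- 1 :: int) ^ ((?p - 1) div 2) = 1"
    unfolding k by (simp add: power_mult)
  have "[Legendre (- 1) ?p = (- 1) ^ ((?p - 1) div 2)] (mod int ?p)"
    by (rule euler_criterion[OF pr gt])
  then have c: "[Legendre (- 1) ?p = 1] (mod int ?p)" unfolding ev .
  have "Legendre (- 1) ?p = 1"
  proof (rule ccontr)
    assume "Legendre (- 1) ?p \<noteq> 1"
    then have "Legendre (- 1) ?p = 0 \<or> Legendre (- 1) ?p = - 1"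
      by (auto simp: Legendre_def split: if_splits)
    with c have "int ?p dvd 1 \<or> int ?p dvd 2"
      by (auto simp: cong_iff_dvd_diff)
    then show False using gt by (auto dest: zdvd_imp_le)
  qed
  then have "QuadRes (int ?p) (- 1)" by (auto simp: Legendre_def split: if_splits)
  then obtain y where "[y\<^sup>2 = - 1] (mod int ?p)" by (auto simp: QuadRes_def)
  then have "of_int (y\<^sup>2) = (of_int (- 1) :: 'p mod_ring)"
    unfolding of_int_of_int_mod_ring cong_def by (transfer) simp
  then show ?thesis by (intro exI[of _ "of_int y"]) simp
qed

lemma root_char_eq:
  fixes c x :: "'p :: prime_card mod_ring"
  assumes p: "CARD('p) mod 4 = 1" and c: "c \<noteq> 0" "x = c\<^sup>2"
  shows "root_char x = quad_char c"
proof -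
  define d where "d = (SOME c. c \<noteq> 0 \<and> x = c\<^sup>2)"
  have d: "d \<noteq> 0 \<and> x = d\<^sup>2" unfolding d_def by (rule someI[of _ c]) (simp add: c)
  obtain i :: "'p mod_ring" where i: "i\<^sup>2 = - 1"
    using minus_one_is_square[OF p] by blast
  have neg: "\<exists>y. - z = y\<^sup>2" if "z = y\<^sup>2" for y z :: "'p mod_ring"
    using i that by (intro exI[of _ "i * y"]) (simp add: power_mult_distrib)
  have sq: "(\<exists>y. - z = y\<^sup>2) \<longleftrightarrow> (\<exists>y. z = y\<^sup>2)" for z :: "'p mod_ring"
    using neg[of z] neg[of "- z"] unfolding minus_minus by blast
  have "d\<^sup>2 = c\<^sup>2" using d c by simp
  then have "d = c \<or> d = - c" by (simp only: power2_eq_iff)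
  then have "quad_char d = quad_char c"
    using sq by (elim disjE) (simp_all only: quad_char_def neg_equal_0_iff_equal)
  moreover have "\<exists>c. c \<noteq> 0 \<and> x = c\<^sup>2" using c by blast
  ultimately show ?thesis unfolding root_char_def d_def by (simp only: if_True)
qed

end

theory Submission
  imports Defs "Berlekamp_Zassenhaus.Berlekamp_Type_Based"
begin

text \<open>Since \<open>p \<equiv> 5 (mod 8)\<close>, \<open>- 1\<close> lies in \<open>C\<^sub>2\<close>, so \<open>X\<close> and \<open>Y\<close> are skew. On the core,
  \<open>R\<^sub>X\<close> is \<open>1\<close> on \<open>C\<^sub>0\<close> and \<open>- 1\<close> on \<open>C\<^sub>2\<close>, and since \<open>2 \<in> C\<^bsub>\<epsilon>+2\<^esub>\<close>, \<open>R\<^sub>Y\<close> is \<open>1\<close> on \<open>C\<^sub>\<epsilon>\<close> and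
  \<open>- 1\<close> on \<open>C\<^bsub>\<epsilon>+2\<^esub>\<close>. Hence the type-1 matrices are signed combinations of \<open>R\<^sub>X\<close>, \<open>R\<^sub>Y\<close> and the
  identity. Moving the two border rows and columns of the matrix for \<open>a\<close> to the front, and for
  \<open>a = - 1\<close> also negating the core rows and the border columns, gives the required matrix.\<close>

section \<open>Powers of a primitive element and membership in the quartic classes\<close>

lemma primitive_element_power_card_minus_one:
  fixes \<omega> :: "'p :: prime_card mod_ring"
  assumes "primitive_element \<omega>"
  shows "\<omega> ^ (CARD('p) - 1) = 1"
proof -
  have w: "\<omega> \<noteq> 0" using assms by (simp add: primitive_element_def)
  have "\<omega> * \<omega> ^ (CARD('p) - 1) = \<omega> ^ CARD('p)"
    by (metis Suc_pred' power_Suc zero_less_card_finite)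
  also have "\<dots> = \<omega> * 1" by (simp add: fermat_theorem_mod_ring)
  finally show ?thesis using w by simp
qed

text \<open>A remainder \<open>m\<close> of \<open>n\<close> strictly between 0 and
  \<open>CARD('p) - 1\<close> would satisfy \<open>\<omega> ^ m = 1\<close> and confine the powers
  of \<open>\<omega>\<close> to at most \<open>m\<close> values, too few to cover the
  \<open>CARD('p) - 1\<close> nonzero elements.\<close>

lemma primitive_element_power_eq_1D:
  fixes \<omega> :: "'p :: prime_card mod_ring"
  assumes prim: "primitive_element \<omega>" and n: "\<omega> ^ n = 1"
  shows "CARD('p) - 1 dvd n"
proof (rule ccontr)
  assume nd: "\<not> CARD('p) - 1 dvd n"
  define m where "m = n mod (CARD('p) - 1)"
  have gt: "CARD('p) > 1" using prime_gt_1_nat[OF prime_card] .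
  have m0: "0 < m" using nd unfolding m_def by (metis gr0I mod_eq_0_iff_dvd)
  have mlt: "m < CARD('p) - 1" using gt by (simp add: m_def)
  have "\<omega> ^ n = \<omega> ^ ((CARD('p) - 1) * (n div (CARD('p) - 1)) + m)"
    by (simp add: m_def)
  then have m1: "\<omega> ^ m = 1"
    using n primitive_element_power_card_minus_one[OF prim]
    by (simp only: power_add power_mult power_one mult_1_left)
  have "UNIV - {0} \<subseteq> (\<lambda>k. \<omega> ^ k) ` {..<m}"
  proof
    fix x :: "'p mod_ring" assume "x \<in> UNIV - {0}"
    then obtain k where k: "x = \<omega> ^ k" using prim by (auto simp: primitive_element_def)
    have "\<omega> ^ k = \<omega> ^ (m * (k div m) + k mod m)" by simp
    also have "\<dots> = \<omega> ^ (k mod m)" using m1 by (simp only: power_add power_mult power_one mult_1_left)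
    finally show "x \<in> (\<lambda>k. \<omega> ^ k) ` {..<m}" using k m0 by auto
  qed
  then have "card (UNIV - {0 :: 'p mod_ring}) \<le> m"
    by (metis card_image_le card_lessThan card_mono finite_imageI finite_lessThan le_trans)
  then show False using mlt by (simp add: card_Diff_singleton)
qed

lemma primitive_element_power_eqD:
  fixes \<omega> :: "'p :: prime_card mod_ring"
  assumes prim: "primitive_element \<omega>" and eq: "\<omega> ^ m = \<omega> ^ n"
  shows "[m = n] (mod CARD('p) - 1)"
proof -
  have w: "\<omega> \<noteq> 0" using prim by (simp add: primitive_element_def)
  have *: "[k = l] (mod CARD('p) - 1)" if "k \<le> l" "\<omega> ^ k = \<omega> ^ l" for k l
  proof -
    have "\<omega> ^ k * \<omega> ^ (l - k) = \<omega> ^ k * 1" using that by (metis le_add_diff_inverse mult_1_right power_add)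
    then have "\<omega> ^ (l - k) = 1" using w by simp
    then have "CARD('p) - 1 dvd l - k" by (rule primitive_element_power_eq_1D[OF prim])
    then show ?thesis using that(1) by (metis cong_altdef_nat cong_sym)
  qed
  show ?thesis using *[of m n] *[of n m] eq by (metis cong_sym nat_le_linear)
qed

text \<open>Exponents are determined modulo \<open>CARD('p) - 1\<close>, a multiple of 4. The
  residue modulo 4 is thus an invariant of a nonzero element, and the later computations with
  quartic classes run on it.\<close>

lemma primitive_element_power_eq_mod_4:
  fixes \<omega> :: "'p :: prime_card mod_ring"
  assumes "CARD('p) mod 4 = 1" "primitive_element \<omega>" "\<omega> ^ m = \<omega> ^ n"
  shows "m mod 4 = n mod 4"
proof -
  have "4 dvd CARD('p) - 1" using assms(1) by (metis dvd_minus_mod)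
  then show ?thesis
    using primitive_element_power_eqD[OF assms(2,3)] by (metis cong_def cong_dvd_modulus_nat)
qed

lemma power_in_quartic_class_iff:
  fixes \<omega> :: "'p :: prime_card mod_ring"
  assumes p: "CARD('p) mod 4 = 1" and prim: "primitive_element \<omega>"
  shows "\<omega> ^ k \<in> quartic_class \<omega> i \<longleftrightarrow> k mod 4 = i mod 4"
proof
  assume "\<omega> ^ k \<in> quartic_class \<omega> i"
  then obtain j where "\<omega> ^ k = \<omega> ^ (i mod 4 + 4 * j)"
    by (auto simp: quartic_class_def power_add power_mult)
  from primitive_element_power_eq_mod_4[OF p prim this] show "k mod 4 = i mod 4" by simp
next
  assume "k mod 4 = i mod 4"
  then have "\<omega> ^ k = \<omega> ^ (i mod 4 + 4 * (k div 4))" by (metis mod_mult_div_eq)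
  then show "\<omega> ^ k \<in> quartic_class \<omega> i"
    by (auto simp: quartic_class_def power_add power_mult)
qed

lemma zero_notin_quartic_class:
  assumes "primitive_element \<omega>"
  shows "0 \<notin> quartic_class \<omega> i"
  using assms by (auto simp: quartic_class_def primitive_element_def)

section \<open>Quadratic and root characters at powers of a primitive element\<close>

lemma quad_char_power:
  fixes \<omega> :: "'p :: prime_card mod_ring"
  assumes p: "CARD('p) mod 4 = 1" and prim: "primitive_element \<omega>"
  shows "quad_char (\<omega> ^ k) = (if even k then 1 else - 1)"
proof -
  have w: "\<omega> \<noteq> 0" using prim by (simp add: primitive_element_def)
  have "(\<exists>y. \<omega> ^ k = y\<^sup>2) \<longleftrightarrow> even k"
  proof
    assume "\<exists>y. \<omega> ^ k = y\<^sup>2"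
    then obtain y where y: "\<omega> ^ k = y\<^sup>2" by blast
    then have "y \<noteq> 0" using w by auto
    then obtain j where "y = \<omega> ^ j" using prim by (auto simp: primitive_element_def)
    then have "\<omega> ^ k = \<omega> ^ (j * 2)" using y by (simp add: power_mult)
    from primitive_element_power_eq_mod_4[OF p prim this] show "even k" by presburger
  next
    assume "even k"
    then have "\<omega> ^ k = (\<omega> ^ (k div 2))\<^sup>2" by (simp flip: power_mult)
    then show "\<exists>y. \<omega> ^ k = y\<^sup>2" ..
  qed
  then show ?thesis using w by (simp add: quad_char_def)
qed

lemma root_char_0: "root_char 0 = 0"
  by (simp add: root_char_def)

text \<open>For even \<open>k\<close> the element \<open>\<omega> ^ (k div 2)\<close> is a square
  root, and its quadratic character is the parity of \<open>k div 2\<close>, that is, whether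
  \<open>k\<close> is 0 or 2 modulo 4. For odd \<open>k\<close> the quadratic character of the power
  is -1, so there is no root.\<close>

lemma root_char_power:
  fixes \<omega> :: "'p :: prime_card mod_ring"
  assumes p: "CARD('p) mod 4 = 1" and prim: "primitive_element \<omega>"
  shows "root_char (\<omega> ^ k) = (if k mod 4 = 0 then 1 else if k mod 4 = 2 then - 1 else 0)"
proof (cases "even k")
  case True
  then have "\<omega> ^ k = (\<omega> ^ (k div 2))\<^sup>2" by (simp flip: power_mult)
  moreover have "\<omega> ^ (k div 2) \<noteq> 0" using prim by (simp add: primitive_element_def)
  ultimately have "root_char (\<omega> ^ k) = quad_char (\<omega> ^ (k div 2))"
    using root_char_eq[OF p] by blast
  moreover have "even (k div 2) \<longleftrightarrow> k mod 4 = 0" "k mod 4 = 0 \<or> k mod 4 = 2"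
    using True by presburger+
  ultimately show ?thesis by (auto simp: quad_char_power[OF p prim])
next
  case False
  have "\<omega> ^ k \<noteq> c\<^sup>2" for c
    using quad_char_power[OF p prim, of k] False by (auto simp: quad_char_def split: if_splits)
  moreover have "k mod 4 \<noteq> 0" "k mod 4 \<noteq> 2" using False by presburger+
  ultimately show ?thesis by (simp add: root_char_def)
qed

text \<open>The exponent \<open>(CARD('p) - 1) div 2\<close> yields a square root of 1, and it is
  not 1 because the order of \<open>\<omega>\<close> is twice this exponent. The residue 5 modulo 8
  makes the exponent 2 modulo 4.\<close>

lemma minus_one_eq_power:
  fixes \<omega> :: "'p :: prime_card mod_ring"
  assumes p: "CARD('p) mod 8 = 5" and prim: "primitive_element \<omega>"
  obtains h where "h mod 4 = 2" "\<omega> ^ h = - 1"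
proof -
  define h where "h = (CARD('p) - 1) div 2"
  have h: "h mod 4 = 2" "2 * h = CARD('p) - 1" using p unfolding h_def by presburger+
  have "(\<omega> ^ h)\<^sup>2 = 1"
    using primitive_element_power_card_minus_one[OF prim] h(2)
    by (metis mult.commute power_mult)
  then have "\<omega> ^ h = 1 \<or> \<omega> ^ h = - 1" by (simp add: power2_eq_1_iff)
  moreover have "\<omega> ^ h \<noteq> 1"
  proof
    assume "\<omega> ^ h = 1"
    then have "2 * h dvd h" using primitive_element_power_eq_1D[OF prim] h(2) by metis
    moreover have "h > 0" using h(1) by (cases h) auto
    ultimately show False by (auto dest: dvd_imp_le)
  qed
  ultimately show ?thesis using that h(1) by blast
qed

text \<open>Multiplication by -1 shifts exponents by 2 modulo 4, so it exchanges the classes of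
  residues 0 and 2, on which the values are opposite. Applied to \<open>x\<close> and to
  \<open>2 * x\<close>, this gives the skewness of both cores.\<close>

lemma root_char_minus:
  fixes x :: "'p :: prime_card mod_ring"
  assumes p: "CARD('p) mod 8 = 5" and prim: "primitive_element (\<omega> :: 'p mod_ring)"
  shows "root_char (- x) = - root_char x"
proof (cases "x = 0")
  case False
  then obtain k where k: "x = \<omega> ^ k" using prim by (auto simp: primitive_element_def)
  obtain h where h: "h mod 4 = 2" "\<omega> ^ h = - 1" using minus_one_eq_power[OF p prim] .
  have p4: "CARD('p) mod 4 = 1" using p by presburger
  have "- x = \<omega> ^ (k + h)" using k h by (simp add: power_add)
  moreover have "(k + h) mod 4 = 0 \<longleftrightarrow> k mod 4 = 2" "(k + h) mod 4 = 2 \<longleftrightarrow> k mod 4 = 0"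
    using h(1) by presburger+
  ultimately show ?thesis using k by (simp add: root_char_power[OF p4 prim])
qed (simp add: root_char_0)

text \<open>For nonzero \<open>x\<close>, all terms depend only on \<epsilon> and the exponent of
  \<open>x\<close> modulo 4, which leaves eight cases. At 0 both characters vanish while the sign is
  -1; the correction \<delta> accounts for this.\<close>

lemma type1_sign_eq_root_char:
  fixes x :: "'p :: prime_card mod_ring"
  assumes p: "CARD('p) mod 8 = 5" and prim: "primitive_element (\<omega> :: 'p mod_ring)"
    and eps: "\<epsilon> \<in> {1, 3}" and two: "- 2 \<in> quartic_class \<omega> \<epsilon>"
  defines "\<delta> \<equiv> (if x = 0 then 1 else 0 :: int)"
  shows "(if x \<in> quartic_class \<omega> 0 \<union> quartic_class \<omega> \<epsilon> then 1 else - 1)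
           = root_char x + root_char (2 * x) - \<delta>" (is ?thesis1)
    and "(if x \<in> quartic_class \<omega> 2 \<union> quartic_class \<omega> (2 + \<epsilon>) then 1 else - 1)
           = - root_char x - root_char (2 * x) - \<delta>" (is ?thesis2)
    and "(if x \<in> quartic_class \<omega> 0 \<union> quartic_class \<omega> (\<epsilon> + 2) then 1 else - 1)
           = root_char x - root_char (2 * x) - \<delta>" (is ?thesis3)
    and "(if x \<in> quartic_class \<omega> 2 \<union> quartic_class \<omega> \<epsilon> then 1 else - 1)
           = - root_char x + root_char (2 * x) - \<delta>" (is ?thesis4)
proof -
  have p4: "CARD('p) mod 4 = 1" using p by presburger
  note mem = power_in_quartic_class_iff[OF p4 prim]
  have "?thesis1 \<and> ?thesis2 \<and> ?thesis3 \<and> ?thesis4" if "x = 0"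
    using that by (simp add: \<delta>_def root_char_0 zero_notin_quartic_class[OF prim])
  moreover have "?thesis1 \<and> ?thesis2 \<and> ?thesis3 \<and> ?thesis4" if x0: "x \<noteq> 0"
  proof -
    obtain k where k: "x = \<omega> ^ k" using prim x0 by (auto simp: primitive_element_def)
    obtain h where h: "h mod 4 = 2" "\<omega> ^ h = - 1" using minus_one_eq_power[OF p prim] .
    have "(- 2 :: 'p mod_ring) \<noteq> 0" using two zero_notin_quartic_class[OF prim] by metis
    then obtain t where t: "- 2 = \<omega> ^ t" using prim unfolding primitive_element_def by blast
    have tm: "t mod 4 = \<epsilon>" using two eps unfolding t mem by (elim insertE) simp_all
    \<comment> \<open>The class of -2 is given, so 2 is factored as -1 times -2; multiplication by 2
      then shifts exponents by \<open>2 + \<epsilon>\<close> modulo 4.\<close>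
    have "2 * x = (- 1) * (- 2) * x" by simp
    also have "\<dots> = \<omega> ^ (h + t + k)" unfolding k t power_add h(2) ..
    finally have x2: "2 * x = \<omega> ^ (h + t + k)" .
    have "(h + t + k) mod 4 = ((h mod 4 + t mod 4) mod 4 + k mod 4) mod 4"
      by (simp only: mod_add_eq)
    then have ht: "(h + t + k) mod 4 = ((2 + \<epsilon>) mod 4 + k mod 4) mod 4" unfolding h(1) tm .
    have m: "x \<in> quartic_class \<omega> i \<longleftrightarrow> k mod 4 = i mod 4" for i
      unfolding k by (rule mem)
    have r1: "root_char x = (if k mod 4 = 0 then 1 else if k mod 4 = 2 then - 1 else 0)"
      unfolding k by (rule root_char_power[OF p4 prim])
    have r2: "root_char (2 * x) = (if ((2 + \<epsilon>) mod 4 + k mod 4) mod 4 = 0 then 1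
        else if ((2 + \<epsilon>) mod 4 + k mod 4) mod 4 = 2 then - 1 else 0)"
      unfolding x2 root_char_power[OF p4 prim] ht ..
    have "k mod 4 = 0 \<or> k mod 4 = 1 \<or> k mod 4 = 2 \<or> k mod 4 = 3" by presburger
    moreover have "\<epsilon> = 1 \<or> \<epsilon> = 3" using eps by simp
    ultimately show ?thesis
      using x0 by (elim disjE) (simp_all add: m r1 r2 \<delta>_def)
  qed
  ultimately show ?thesis1 ?thesis2 ?thesis3 ?thesis4 by blast+
qed

section \<open>Equivalence through signed permutations of rows and columns\<close>

lemma elements_mat_subsetI:
  assumes "A \<in> carrier_mat m n" "\<And>i j. i < m \<Longrightarrow> j < n \<Longrightarrow> A $$ (i, j) \<in> S"
  shows "elements_mat A \<subseteq> S"
  using assms by (auto dest!: elements_matD)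

text \<open>The first shape serves as a left factor, putting \<open>s i\<close> times row
  \<open>f i\<close> in row \<open>i\<close>; the second serves as a right factor and does the same
  for columns.\<close>

lemma signed_permutation_mat:
  assumes f: "bij_betw f {..<n} {..<n}" and s: "\<And>i. i < n \<Longrightarrow> s i \<in> {1, - 1}"
  shows "signed_monomial_mat n (mat n n (\<lambda>(i, j). if j = f i then s i else 0))"
    and "signed_monomial_mat n (mat n n (\<lambda>(i, j). if i = f j then s j else 0))"
proof -
  have s0: "s i \<noteq> 0" if "i < n" for i using s[OF that] by auto
  have s': "s i = - 1" if "s i \<noteq> 1" "i < n" for i using s[OF that(2)] that(1) by auto
  have fn: "f i < n" if "i < n" for i using f that by (auto simp: bij_betw_def)
  have ex1: "\<exists>!i. i < n \<and> f i = j" if "j < n" for j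
  proof -
    from that have "j \<in> f ` {..<n}" using bij_betw_imp_surj_on[OF f] by simp
    then show ?thesis using inj_onD[OF bij_betw_imp_inj_on[OF f]] by auto
  qed
  have e1: "\<exists>!j. j < n \<and> (if j = f i then s i else 0) \<noteq> 0" if "i < n" for i
    using that s0[OF that] fn[OF that] by auto
  have e2: "\<exists>!i. i < n \<and> (if j = f i then s i else 0) \<noteq> 0" if "j < n" for j
  proof -
    have "i < n \<and> (if j = f i then s i else 0) \<noteq> 0 \<longleftrightarrow> i < n \<and> f i = j" for i
      using s0[of i] by auto
    then show ?thesis using ex1[OF that] by simp
  qed
  show "signed_monomial_mat n (mat n n (\<lambda>(i, j). if j = f i then s i else 0))"
    "signed_monomial_mat n (mat n n (\<lambda>(i, j). if i = f j then s j else 0))"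
    using e1 e2 s' by (auto simp: signed_monomial_mat_def elements_mat_def cong: conj_cong)
qed

lemma pm_equivalentI:
  assumes H: "H \<in> carrier_mat n n" and K: "K \<in> carrier_mat n n"
    and f: "bij_betw f {..<n} {..<n}" and g: "bij_betw g {..<n} {..<n}"
    and s: "\<And>i. i < n \<Longrightarrow> s i \<in> {1, - 1}" and t: "\<And>i. i < n \<Longrightarrow> t i \<in> {1, - 1}"
    and eq: "\<And>i j. i < n \<Longrightarrow> j < n \<Longrightarrow> K $$ (i, j) = s i * H $$ (f i, g j) * t j"
    and el: "elements_mat K \<subseteq> {1, - 1}"
  shows "pm_equivalent H K"
proof -
  define P where "P = mat n n (\<lambda>(i, j). if j = f i then s i else 0)"
  define Q where "Q = mat n n (\<lambda>(i, j). if i = g j then t j else 0)"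
  have fn: "f i < n" "g i < n" if "i < n" for i
    using f g that by (auto simp: bij_betw_def)
  \<comment> \<open>As \<open>f\<close> and \<open>g\<close> are onto, every entry of
    \<open>H\<close> is up to sign an entry of \<open>K\<close>.\<close>
  have "elements_mat H \<subseteq> {1, - 1}"
  proof (rule elements_mat_subsetI[OF H])
    fix i j assume that: "i < n" "j < n"
    have "i \<in> f ` {..<n}" "j \<in> g ` {..<n}"
      using that bij_betw_imp_surj_on[OF f] bij_betw_imp_surj_on[OF g] by simp_all
    then obtain i' j' where ij: "i' < n" "j' < n" "i = f i'" "j = g j'" by auto
    have "K $$ (i', j') \<in> {1, - 1}" using el K ij elements_matI[OF K] by blast
    then show "H $$ (i, j) \<in> {1, - 1}" using s[OF ij(1)] t[OF ij(2)] eq[OF ij(1,2)] ij(3,4) by auto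
  qed
  moreover have "K = P * H * Q"
  proof (rule eq_matI)
    fix i j assume "i < dim_row (P * H * Q)" "j < dim_col (P * H * Q)"
    then have ij: "i < n" "j < n" by (auto simp: P_def Q_def)
    have PH: "(P * H) $$ (i, k) = s i * H $$ (f i, k)" if "k < n" for k
    proof -
      have "(P * H) $$ (i, k) = (\<Sum>l<n. (if l = f i then s i else 0) * H $$ (l, k))"
        using ij H that by (simp add: P_def scalar_prod_def lessThan_atLeast0)
      also have "\<dots> = (\<Sum>l<n. if l = f i then s i * H $$ (l, k) else 0)"
        by (rule sum.cong) auto
      finally show ?thesis using fn ij by simp
    qed
    have "(P * H * Q) $$ (i, j) = (\<Sum>k<n. (P * H) $$ (i, k) * (if k = g j then t j else 0))"
      using ij H by (simp add: P_def Q_def scalar_prod_def lessThan_atLeast0)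
    also have "\<dots> = (\<Sum>k<n. if k = g j then s i * H $$ (f i, k) * t j else 0)"
      by (rule sum.cong) (auto simp: PH)
    finally show "K $$ (i, j) = (P * H * Q) $$ (i, j)" using fn ij eq by simp
  qed (use H K in \<open>auto simp: P_def Q_def\<close>)
  ultimately show ?thesis
    using signed_permutation_mat(1)[of f n s, OF f s, folded P_def]
      signed_permutation_mat(2)[of g n t, OF g t, folded Q_def] H el
    unfolding pm_equivalent_def by auto
qed

section \<open>Entries of the two block matrices and their comparison\<close>

lemma H_mat_carrier:
  "H_mat (e :: nat \<Rightarrow> 'p :: prime_card mod_ring) D1 D2 \<in> carrier_mat (2 * CARD('p) + 2) (2 * CARD('p) + 2)"
  by (auto simp: H_mat_def Let_def ones_mat_def type1_mat_def mat_of_rows_list_def)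

lemma H_NV_carrier:
  "H_NV a (e :: nat \<Rightarrow> 'p :: prime_card mod_ring) \<in> carrier_mat (2 * CARD('p) + 2) (2 * CARD('p) + 2)"
  by (auto simp: H_NV_def Let_def ones_mat_def X_mat_def Y_mat_def R_X_def R_Y_def)

lemma bordered_index_cases:
  fixes i p :: nat
  assumes "i < 2 * p + 2"
  obtains "i = 0" | "i = 1" | k where "k < p" "i = k + 2" | k where "k < p" "i = k + p + 2"
proof -
  consider "i < 2" | "2 \<le> i" "i < p + 2" | "p + 2 \<le> i" by linarith
  then show ?thesis
  proof cases
    case 1
    then show ?thesis using that(1,2) by linarith
  next
    case 2
    then show ?thesis using that(3)[of "i - 2"] by simp
  next
    case 3
    then show ?thesis using that(4)[of "i - p - 2"] assms by simp
  qed
qed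

lemma H_mat_index:
  fixes e :: "nat \<Rightarrow> 'p :: prime_card mod_ring"
  assumes "i < 2 * CARD('p) + 2" "j < 2 * CARD('p) + 2"
  defines "p \<equiv> CARD('p)"
  shows "H_mat e D1 D2 $$ (i, j) =
    (if i < 2 then if j < 2 then if i = 1 \<and> j = 0 then - 1 else 1
       else if i = 0 \<and> j < p + 2 then 1 else - 1
     else if i < p + 2 then if j = 0 then - 1 else if j = 1 then 1
       else if j < p + 2 then if e (j - 2) - e (i - 2) \<in> D1 then - 1 else 1
       else if e (j - p - 2) - e (i - 2) \<in> D2 then - 1 else 1
     else if j < 2 then 1
       else if j < p + 2 then if e (i - p - 2) - e (j - 2) \<in> D2 then 1 else - 1
       else if e (i - p - 2) - e (j - p - 2) \<in> D1 then - 1 else 1)"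
  unfolding H_mat_def Let_def p_def[symmetric]
  by (rule bordered_index_cases[OF assms(1), folded p_def];
      rule bordered_index_cases[OF assms(2), folded p_def];
      hypsubst; simp add: ones_mat_def type1_mat_def mat_of_rows_list_def flip: p_def)

text \<open>Transposition appears as an exchange of the arguments of \<open>x\<close> and
  \<open>y\<close>. Index 0 is the border, so a core index \<open>k\<close> belongs to the field
  element \<open>e (k - 1)\<close>.\<close>

lemma H_NV_index:
  fixes e :: "nat \<Rightarrow> 'p :: prime_card mod_ring" and a :: int
  assumes "i < 2 * CARD('p) + 2" "j < 2 * CARD('p) + 2"
  defines "p \<equiv> CARD('p)"
  defines "x \<equiv> \<lambda>k l. if k = 0 then if l = 0 then 0 else 1
      else if l = 0 then - 1 else root_char (e (l - 1) - e (k - 1))"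
  defines "y \<equiv> \<lambda>k l. if k = 0 \<or> l = 0 then 0 else root_char (2 * (e (l - 1) - e (k - 1)))"
  defines "d \<equiv> \<lambda>k l. if k = l then a else 0"
  shows "H_NV a e $$ (i, j) =
    (if i < p + 1
     then if j < p + 1 then x i j - y j i + d i j
       else y i (j - (p + 1)) + x (j - (p + 1)) i + d i (j - (p + 1))
     else if j < p + 1 then - y j (i - (p + 1)) - x (i - (p + 1)) j - d (i - (p + 1)) j
       else x (j - (p + 1)) (i - (p + 1)) - y (i - (p + 1)) (j - (p + 1))
         + d (i - (p + 1)) (j - (p + 1)))"
proof -
  have x: "X_mat e $$ (k, l) = x k l" and y: "Y_mat e $$ (k, l) = y k l"
    if "k < p + 1" "l < p + 1" for k l
    using that
    by (auto simp: X_mat_def Y_mat_def R_X_def R_Y_def ones_mat_def x_def y_def simp flip: p_def)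
  have dim: "X_mat e \<in> carrier_mat (p + 1) (p + 1)" "Y_mat e \<in> carrier_mat (p + 1) (p + 1)"
    by (auto simp: X_mat_def Y_mat_def R_X_def R_Y_def ones_mat_def p_def)
  then show ?thesis
    using assms(1,2) unfolding H_NV_def Let_def
    by (simp add: x y d_def flip: p_def)
qed

lemma elements_H_mat:
  "elements_mat (H_mat (e :: nat \<Rightarrow> 'p :: prime_card mod_ring) D1 D2) \<subseteq> {1, - 1}"
proof -
  have "H_mat e D1 D2 $$ (i, j) \<in> {1, - 1}" if "i < 2 * CARD('p) + 2" "j < 2 * CARD('p) + 2" for i j
    using that by (simp add: H_mat_index)
  then show ?thesis by (rule elements_mat_subsetI[OF H_mat_carrier])
qed

text \<open>The border of \<^const>\<open>H_NV\<close> has indices \<open>0\<close> and \<open>p + 1\<close>, that of \<^const>\<open>H_mat\<close> has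
  \<open>0\<close> and \<open>1\<close>.\<close>

definition border_first :: "nat \<Rightarrow> nat \<Rightarrow> nat" where
  "border_first p i = (if i = 0 then 0 else if i = 1 then p + 1 else if i < p + 2 then i - 1 else i)"

lemma bij_betw_border_first: "bij_betw (border_first p) {..<2 * p + 2} {..<2 * p + 2}"
  by (rule bij_betw_byWitness[where f' = "\<lambda>i. if i = 0 then 0 else if i = p + 1 then 1
        else if i < p + 1 then i + 1 else i"])
     (auto simp: border_first_def)

text \<open>The 2 by 2 border corner comes from the \<open>a\<close> times identity blocks, so the
  border column sign \<open>a\<close> turns it into the required signs. Entries in core rows and
  border columns receive \<open>a\<close> twice and do not change; those in border rows and core
  columns receive no sign. In the core, the row sign turns \<open>a\<close> times the identity into
  the identity and gives the character combinations of \<open>D1\<close> and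
  \<open>D2\<close>.\<close>

lemma H_mat_eq_signed_permuted_H_NV:
  fixes e :: "nat \<Rightarrow> 'p :: prime_card mod_ring"
  assumes e: "inj_on e {..<CARD('p)}" and a: "a \<in> {1, - 1}"
    and skew: "\<And>x :: 'p mod_ring. root_char (- x) = - root_char x"
    and D1: "\<And>x. (if x \<in> D1 then 1 else - 1)
               = - a * (root_char x + root_char (2 * x)) - (if x = 0 then 1 else 0)"
    and D2: "\<And>x. (if x \<in> D2 then 1 else - 1)
               = a * (root_char x - root_char (2 * x)) - (if x = 0 then 1 else 0)"
    and ij: "i < 2 * CARD('p) + 2" "j < 2 * CARD('p) + 2"
  shows "H_mat e D1 D2 $$ (i, j)
     = (if i < 2 then 1 else a)
         * H_NV a e $$ (border_first CARD('p) i, border_first CARD('p) j)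
         * (if j < 2 then a else 1)"
proof -
  define p where "p = CARD('p)"
  have inj: "e k = e l \<longleftrightarrow> k = l" if "k < p" "l < p" for k l
    using e that by (auto simp: p_def inj_on_def)
  define r where "r x = root_char x" for x :: "'p mod_ring"
  define r2 where "r2 x = root_char (2 * x)" for x :: "'p mod_ring"
  have "r (- x) = - r x" "r2 (- x) = - r2 x" for x
    using skew[of x] skew[of "2 * x"] by (simp_all add: r_def r2_def)
  \<comment> \<open>In each core block, one of the two character terms occurs at opposite
    differences on the two sides of the equation. Skewness in this form closes what is left after
    the other terms cancel.\<close>
  then have sk: "a * r (e k - e l) + a * r (e l - e k) = 0"
    "a * r2 (e k - e l) + a * r2 (e l - e k) = 0" for k l
    by (metis minus_diff_eq mult_minus_right right_minus)+
  have r0: "r 0 = 0" "r2 0 = 0" by (simp_all add: r_def r2_def root_char_0)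
  have a2: "a * a = 1" using a by auto
  have b: "border_first p i < 2 * p + 2" "border_first p j < 2 * p + 2"
    using ij by (auto simp: border_first_def p_def)
  note idx = H_mat_index[OF ij, of e D1 D2, folded p_def r_def r2_def]
    H_NV_index[OF b[unfolded p_def], of a e, folded p_def r_def r2_def]
  \<comment> \<open>These are the sign patterns of the core: negated \<open>M1\<close> in both
    diagonal blocks, \<open>M2\<close> transposed, and negated \<open>M2\<close>.\<close>
  have D: "(if x \<in> D1 then - 1 else 1) = a * (r x + r2 x) + (if x = 0 then 1 else 0)"
    "(if x \<in> D2 then 1 else - 1) = a * (r x - r2 x) - (if x = 0 then 1 else 0)"
    "(if x \<in> D2 then - 1 else 1) = a * (r2 x - r x) + (if x = 0 then 1 else 0)" for x
    using D1[of x, folded r_def r2_def] D2[of x, folded r_def r2_def]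
    by (auto simp: algebra_simps split: if_splits)
  show ?thesis
    unfolding p_def[symmetric] idx unfolding D
    by (rule bordered_index_cases[OF ij(1), folded p_def];
      rule bordered_index_cases[OF ij(2), folded p_def]; hypsubst)
      (auto simp: border_first_def inj r0 a2 algebra_simps intro: sk)
qed

lemma pm_equivalent_H_NV_H_mat:
  fixes e :: "nat \<Rightarrow> 'p :: prime_card mod_ring"
  assumes "inj_on e {..<CARD('p)}" "a \<in> {1, - 1}"
    and "\<And>x :: 'p mod_ring. root_char (- x) = - root_char x"
    and "\<And>x. (if x \<in> D1 then 1 else - 1)
           = - a * (root_char x + root_char (2 * x)) - (if x = 0 then 1 else 0)"
    and "\<And>x. (if x \<in> D2 then 1 else - 1)
           = a * (root_char x - root_char (2 * x)) - (if x = 0 then 1 else 0)"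
  shows "pm_equivalent (H_NV a e) (H_mat e D1 D2)"
proof (rule pm_equivalentI[OF H_NV_carrier H_mat_carrier bij_betw_border_first
      bij_betw_border_first _ _ _ elements_H_mat])
  show "H_mat e D1 D2 $$ (i, j)
     = (if i < 2 then 1 else a)
         * H_NV a e $$ (border_first CARD('p) i, border_first CARD('p) j)
         * (if j < 2 then a else 1)"
    if "i < 2 * CARD('p) + 2" "j < 2 * CARD('p) + 2" for i j
    using that by (rule H_mat_eq_signed_permuted_H_NV[OF assms])
qed (use assms(2) in auto)

theorem theorem3p4:
  fixes e :: "nat \<Rightarrow> 'p :: prime_card mod_ring"
    and \<omega> :: "'p mod_ring"
    and \<epsilon> :: nat
  assumes "[CARD('p) = 5] (mod 24)"
    and "bij_betw e {..<CARD('p)} UNIV"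
    and "primitive_element \<omega>"
    and "\<epsilon> \<in> {1, 3}"
    and "- 2 \<in> quartic_class \<omega> \<epsilon>"
  shows "pm_equivalent (H_NV 1 e)
           (H_mat e (quartic_class \<omega> 2 \<union> quartic_class \<omega> (2 + \<epsilon>))
                    (quartic_class \<omega> 0 \<union> quartic_class \<omega> (\<epsilon> + 2)))
       \<and> pm_equivalent (H_NV (- 1) e)
           (H_mat e (quartic_class \<omega> 0 \<union> quartic_class \<omega> \<epsilon>)
                    (quartic_class \<omega> 2 \<union> quartic_class \<omega> \<epsilon>))"
proof -
  have p: "CARD('p) mod 8 = 5"
    using assms(1) mod_mod_cancel[of 8 24 "CARD('p)"] by (simp add: cong_def)
  have inj: "inj_on e {..<CARD('p)}" using assms(2) by (rule bij_betw_imp_inj_on)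
  note sign = type1_sign_eq_root_char[OF p assms(3-5)]
  note equiv = pm_equivalent_H_NV_H_mat[OF inj _ root_char_minus[OF p assms(3)]]
  show ?thesis
  proof
    show "pm_equivalent (H_NV 1 e)
        (H_mat e (quartic_class \<omega> 2 \<union> quartic_class \<omega> (2 + \<epsilon>))
          (quartic_class \<omega> 0 \<union> quartic_class \<omega> (\<epsilon> + 2)))"
      \<comment> \<open>The second and third identities in \<open>sign\<close> are the conditions on
        \<open>D1\<close> and \<open>D2\<close> for \<open>a = 1\<close>; the first and fourth are
        those for \<open>a = - 1\<close>.\<close>
      by (rule equiv) (unfold sign, auto)
    show "pm_equivalent (H_NV (- 1) e)
        (H_mat e (quartic_class \<omega> 0 \<union> quartic_class \<omega> \<epsilon>)
          (quartic_class \<omega> 2 \<union> quartic_class \<omega> \<epsilon>))"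
      by (rule equiv) (unfold sign, auto)
  qed
qed

end
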